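(* Let $V=V(\phi)$ be a given scalar-field potential, and put $x=3\sqrt{2}\,\phi$, $\chi=\ln|V|$ (regarded as a function of $x$), $\kappa=\pm1$; a prime denotes $d/dx$. Then the hamiltonian $W=W(x,C)$ corresponding to $V$ is given by $$W(x,C)=V(x)\left(\frac{\left(y+\sqrt{y^2-1}\right)^2+1}{1-\left(y+\sqrt{y^2-1}\right)^2}\right)^2,$$ where $y=y(x,C)\neq\pm1$ is the general solution of the Abel equation of the first kind $$y'=-\tfrac12\,(y^2-1)\,(\kappa-\chi' y).$$ Moreover, the special case $V=0$ occurs if and only if $y=\pm1$, and in this case the hamiltonian has the form $$W=C e^{\kappa x}.$$
   Context: Setting: spatially flat ($k=0$) Friedmann universe filled with a scalar field $\phi(t)$ with self-action potential $V(\phi)$: $$\ddot\phi+3H\dot\phi+\frac{dV}{d\phi}=0,\qquad H^2=\tfrac12\dot\phi^2+V,\qquad H=\dot a/a,$$ where a dot denotes $d/dt$ and $a(t)$ is the scale factor. The functional of full energy (hamiltonian) is $W=\tfrac12\dot\phi^2+V(\phi)$. It is assumed that $W\neq0$. The hamiltonian corresponding to a given $V$, regarded as a function $W=W(\phi,C)$ of the field, is the general solution of the first-order ordinary differential equation $$V(\phi)=W(\phi)-\frac{1}{18}\,\frac{(dW/d\phi)^2}{W(\phi)} ,$$ which in the variable $x=3\sqrt2\,\phi$ reads $V=W-(W')^2/W$, with $'=d/dx$. "General solution" of a first-order ODE means a family of solutions depending on one arbitrary integration constant $C$. The squared factor in the formula for $W$ equals $y^2/(y^2-1)$; in the special case $V=0$,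 $y=\pm1$ (where $\chi=\ln|V|$ is undefined) the relation between $W$, $V$ and $y$ is understood in the form $W\,(y^2-1)=V\,y^2$. *)

theory Defs
  imports "HOL-Analysis.Analysis"
begin

definition x_of :: "real \<Rightarrow> real" where
  "x_of \<phi> = 3 * sqrt 2 * \<phi>"

definition phi_of :: "real \<Rightarrow> real" where
  "phi_of x = x / (3 * sqrt 2)"

(* The equation V = W - (dW/dphi)^2 / (18 W), with all functions depending on the field phi. *)
definition hamiltonian_on :: "(real \<Rightarrow> real) \<Rightarrow> real set \<Rightarrow> (real \<Rightarrow> real) \<Rightarrow> bool" where
  "hamiltonian_on V S W \<longleftrightarrow>
     (\<forall>\<phi>\<in>S. W \<phi> \<noteq> 0 \<and> W field_differentiable (at \<phi>) \<and>
        V \<phi> = W \<phi> - 1 / 18 * ((deriv W \<phi>)\<^sup>2 / W \<phi>))"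

(* The same equation for W written as a function of x = 3 sqrt(2) phi and S a set of values of x;
   V remains a function of phi. *)
definition hamiltonian_x :: "(real \<Rightarrow> real) \<Rightarrow> real set \<Rightarrow> (real \<Rightarrow> real) \<Rightarrow> bool" where
  "hamiltonian_x V S W \<longleftrightarrow> hamiltonian_on V (x_of -` S) (W \<circ> x_of)"

(* The equation F(W, p) = W - p^2/W - V = 0, p = W', is not solved for W'. The condition W' \<noteq> 0
   is dF/dp \<noteq> 0; it removes the singular solution W = V (which exists for constant V and belongs to
   no one-parameter family) and the points where W = V, at which y = kappa W/W' is infinite. *)
definition regular_hamiltonian_x :: "(real \<Rightarrow> real) \<Rightarrow> real set \<Rightarrow> (real \<Rightarrow> real) \<Rightarrow> bool" where
  "regular_hamiltonian_x V S W \<longleftrightarrow> hamiltonian_x V S W \<and> (\<forall>x\<in>S. deriv W x \<noteq> 0)"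

definition log_potential :: "(real \<Rightarrow> real) \<Rightarrow> real \<Rightarrow> real" where
  "log_potential V x = ln \<bar>V (phi_of x)\<bar>"

definition abel_solution :: "(real \<Rightarrow> real) \<Rightarrow> real \<Rightarrow> real set \<Rightarrow> (real \<Rightarrow> real) \<Rightarrow> bool" where
  "abel_solution V \<kappa> S y \<longleftrightarrow>
     (\<forall>x\<in>S. y x \<noteq> 1 \<and> y x \<noteq> -1 \<and>
        (y has_real_derivative
           - (1 / 2) * ((y x)\<^sup>2 - 1) * (\<kappa> - deriv (log_potential V) x * y x)) (at x))"

(* The root is complex because |y| < 1 occurs, namely where V and W have opposite signs;
   the value is real, and does not depend on the branch. *)
definition squared_factor :: "real \<Rightarrow> complex" where
  "squared_factor y =
     (let z = complex_of_real y + csqrt (complex_of_real (y\<^sup>2 - 1))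
      in ((z\<^sup>2 + 1) / (1 - z\<^sup>2))\<^sup>2)"

(* Sol S u says that u solves the given equation at all points of S. The constant C ranges over P,
   and the member u(., C) lives on an open set D C depending on C, since solutions may
   blow up at points depending on C. Every solution on an open interval is obtained for exactly
   one value of the constant. *)
definition general_solution ::
    "(real set \<Rightarrow> (real \<Rightarrow> real) \<Rightarrow> bool) \<Rightarrow> real set \<Rightarrow> real set \<Rightarrow> (real \<Rightarrow> real set)
       \<Rightarrow> (real \<Rightarrow> real \<Rightarrow> real) \<Rightarrow> bool" where
  "general_solution Sol I P D u \<longleftrightarrow>
     (\<forall>C\<in>P. open (D C) \<and> D C \<noteq> {} \<and> D C \<subseteq> I \<and> Sol (D C) (\<lambda>x. u x C)) \<and>
     (\<forall>J v. open J \<and> is_interval J \<and> J \<noteq> {} \<and> J \<subseteq> I \<and> Sol J v \<longrightarrow>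
        (\<exists>!C. C \<in> P \<and> J \<subseteq> D C \<and> (\<forall>x\<in>J. v x = u x C)))"

end

theory Submission imports Defs begin

text \<open>A hamiltonian \<open>W\<close> with \<open>W' \<noteq> 0\<close> and a solution \<open>y\<close> of the Abel equation determine each other
  through \<open>y = \<kappa> W / W'\<close>, \<open>W = V y\<^sup>2 / (y\<^sup>2 - 1)\<close>. Since \<open>V\<close> is only once differentiable, the
  existence of \<open>W''\<close> has to be proved: \<open>W'\<close> is a square root of the differentiable function
  \<open>W\<^sup>2 - V W\<close> that does not vanish, and being a derivative it has locally constant sign.\<close>

section \<open>Sign and differentiability of a nonvanishing derivative\<close>

text \<open>Darboux's theorem at the value 0. Equal values of \<open>f\<close> at two points would
  give a zero of \<open>p\<close> by the mean value theorem, so \<open>f\<close> is injective and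
  continuous on an interval, hence strictly monotone, and its derivative has one weak sign.\<close>

lemma derivative_nonzero_imp_constant_sign:
  fixes f p :: "real \<Rightarrow> real"
  assumes J: "open J" "is_interval J"
    and der: "\<And>x. x \<in> J \<Longrightarrow> (f has_real_derivative p x) (at x)"
    and nz: "\<And>x. x \<in> J \<Longrightarrow> p x \<noteq> 0"
  shows "(\<forall>x\<in>J. p x > 0) \<or> (\<forall>x\<in>J. p x < 0)"
proof -
  have cont: "continuous_on J f"
    using der by (meson DERIV_isCont continuous_at_imp_continuous_on)
  have neq: "f a \<noteq> f b" if "a \<in> J" "b \<in> J" "a < b" for a b
  proof
    assume eq: "f a = f b"
    have sub: "{a..b} \<subseteq> J"
      using that J(2) by (meson atLeastAtMost_iff is_interval_1 subsetI)
    have "\<exists>z>a. z < b \<and> f b - f a = (b - a) * p z"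
      by (rule MVT2) (use that sub der in auto)
    then obtain z where "a < z" "z < b" "(b - a) * p z = 0"
      using eq by auto
    with sub have "z \<in> J" "p z = 0" by auto
    with nz show False by blast
  qed
  have "inj_on f J"
    by (rule linorder_inj_onI) (use neq in auto)
  then consider "strict_mono_on J f" | "strict_antimono_on J f"
    using injective_eq_monotone_map[OF J(2) cont] by blast
  then show ?thesis
  proof cases
    case 1
    then have "mono_on J f" by (simp add: strict_mono_on_imp_mono_on)
    then have "p x \<ge> 0" if "x \<in> J" for x
      using mono_on_imp_deriv_nonneg der that J(1) by (metis interior_open)
    then show ?thesis using nz by (metis order_le_less)
  next
    case 2
    then have "mono_on J (\<lambda>x. - f x)"
      by (auto simp: monotone_on_def order_le_less)
    moreover have "((\<lambda>x. - f x) has_real_derivative - p x) (at x)" if "x \<in> J" for x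
      using der[OF that] by (rule DERIV_minus)
    ultimately have "- p x \<ge> 0" if "x \<in> J" for x
      using mono_on_imp_deriv_nonneg that J(1) by (metis interior_open)
    then show ?thesis using nz by (metis neg_0_le_iff_le order_le_less)
  qed
qed

text \<open>Differentiating \<open>p\<^sup>2 = q\<close> yields the formula once \<open>p\<close> is
  known to be differentiable. That follows because near \<open>x\<close> the sign of
  \<open>p\<close> is fixed, so \<open>p\<close> is a constant multiple of the square root of the
  positive function \<open>q\<close>.\<close>

lemma derivative_sqrt_has_real_derivative:
  fixes f p q :: "real \<Rightarrow> real"
  assumes "open S" "x \<in> S"
    and der: "\<And>t. t \<in> S \<Longrightarrow> (f has_real_derivative p t) (at t)"
    and nz: "\<And>t. t \<in> S \<Longrightarrow> p t \<noteq> 0"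
    and sq: "\<And>t. t \<in> S \<Longrightarrow> (p t)\<^sup>2 = q t"
    and q': "(q has_real_derivative q') (at x)"
  shows "(p has_real_derivative q' / (2 * p x)) (at x)"
proof -
  \<comment> \<open>\<open>S\<close> is only open, so the sign argument is carried out on a ball,
    which is an interval.\<close>
  obtain e where e: "e > 0" "ball x e \<subseteq> S"
    using assms(1,2) openE by blast
  have x: "x \<in> ball x e" using e by simp
  have "(\<forall>t\<in>ball x e. p t > 0) \<or> (\<forall>t\<in>ball x e. p t < 0)"
    by (rule derivative_nonzero_imp_constant_sign[of _ f]) (use e der nz in \<open>auto simp: is_interval_ball_real\<close>)
  then obtain s :: real where s: "s = 1 \<or> s = -1" "\<And>t. t \<in> ball x e \<Longrightarrow> p t = s * \<bar>p t\<bar>"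
    by (metis abs_of_neg abs_of_pos mult_1 mult_minus1 minus_minus)
  have root: "p t = s * sqrt (q t)" if "t \<in> ball x e" for t
    using s(2)[OF that] sq[of t] that e(2) by (metis real_sqrt_abs subsetD)
  have "q x > 0"
    using sq[OF assms(2)] nz[OF assms(2)] by (metis zero_less_power2)
  then have "((\<lambda>t. s * sqrt (q t)) has_real_derivative s * (q' * (inverse (sqrt (q x)) / 2))) (at x)"
    using q' by (auto intro!: derivative_eq_intros)
  \<comment> \<open>Since \<open>s\<close> is 1 or -1, it is its own reciprocal, so
    \<open>s / sqrt (q x) = 1 / p x\<close>.\<close>
  moreover have "s * (q' * (inverse (sqrt (q x)) / 2)) = q' / (2 * p x)"
    using root[OF x] s(1) by (auto simp: field_simps)
  ultimately have "((\<lambda>t. s * sqrt (q t)) has_real_derivative q' / (2 * p x)) (at x)"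
    by (rule DERIV_cong)
  then show ?thesis
    by (rule has_field_derivative_transform_within_open[OF _ open_ball x]) (use root in auto)
qed

section \<open>Change of variable between the field and \<open>x\<close>\<close>

lemma x_of_phi_of [simp]: "x_of (phi_of x) = x" and phi_of_x_of [simp]: "phi_of (x_of t) = t"
  by (simp_all add: x_of_def phi_of_def)

lemma x_of_has_real_derivative: "(x_of has_real_derivative 3 * sqrt 2) (at t)"
  unfolding x_of_def by (auto intro!: derivative_eq_intros)

lemma phi_of_has_real_derivative: "(phi_of has_real_derivative 1 / (3 * sqrt 2)) (at x)"
  unfolding phi_of_def by (rule DERIV_cdivide) (rule DERIV_ident)

lemma field_differentiable_comp_x_of_iff:
  "(W \<circ> x_of) field_differentiable (at (phi_of x)) \<longleftrightarrow> W field_differentiable (at x)"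
proof
  assume "(W \<circ> x_of) field_differentiable (at (phi_of x))"
  then have "(W \<circ> x_of \<circ> phi_of) field_differentiable (at x)"
    by (rule field_differentiable_compose[rotated])
      (use phi_of_has_real_derivative field_differentiable_def in blast)
  moreover have "W \<circ> x_of \<circ> phi_of = W" by auto
  ultimately show "W field_differentiable (at x)" by simp
next
  assume "W field_differentiable (at x)"
  then show "(W \<circ> x_of) field_differentiable (at (phi_of x))"
    by (intro field_differentiable_compose)
      (use x_of_has_real_derivative field_differentiable_def in \<open>auto\<close>)
qed

lemma deriv_comp_x_of:
  assumes "W field_differentiable (at x)"
  shows "deriv (W \<circ> x_of) (phi_of x) = 3 * sqrt 2 * deriv W x"
proof -
  have "(W has_real_derivative deriv W x) (at (x_of (phi_of x)))"
    using assms by (simp add: DERIV_deriv_iff_field_differentiable)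
  from DERIV_chain[OF this x_of_has_real_derivative] show ?thesis
    by (simp add: DERIV_imp_deriv mult.commute)
qed

text \<open>By the chain rule the squared derivative gains the factor
  \<open>(3 * sqrt 2)\<^sup>2 = 18\<close>, which cancels the coefficient 1/18.\<close>

lemma hamiltonian_x_iff:
  "hamiltonian_x V S W \<longleftrightarrow>
     (\<forall>x\<in>S. W x \<noteq> 0 \<and> W field_differentiable (at x) \<and>
        V (phi_of x) = W x - (deriv W x)\<^sup>2 / W x)"
proof -
  have "hamiltonian_x V S W \<longleftrightarrow>
     (\<forall>x\<in>S. (W \<circ> x_of) (phi_of x) \<noteq> 0 \<and> (W \<circ> x_of) field_differentiable (at (phi_of x)) \<and>
        V (phi_of x) = (W \<circ> x_of) (phi_of x)
          - 1 / 18 * ((deriv (W \<circ> x_of) (phi_of x))\<^sup>2 / (W \<circ> x_of) (phi_of x)))"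
    unfolding hamiltonian_x_def hamiltonian_on_def by (metis phi_of_x_of x_of_phi_of vimageE vimageI2)
  also have "\<dots> \<longleftrightarrow> (\<forall>x\<in>S. W x \<noteq> 0 \<and> W field_differentiable (at x) \<and>
        V (phi_of x) = W x - (deriv W x)\<^sup>2 / W x)"
    by (intro ball_cong refl conj_cong)
      (simp_all add: field_differentiable_comp_x_of_iff deriv_comp_x_of power_mult_distrib)
  finally show ?thesis .
qed

section \<open>The squared factor and the logarithm of the potential\<close>

text \<open>With \<open>s\<^sup>2 = y\<^sup>2 - 1\<close> the reciprocal of \<open>z = y + s\<close>
  is \<open>y - s\<close>. Hence \<open>z + 1/z = 2 * y\<close> and
  \<open>1/z - z = - 2 * s\<close>, so the quotient is \<open>- y / s\<close>; squaring it removes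
  the dependence on the branch of the root.\<close>

lemma squared_factor_eq:
  assumes "y \<noteq> 1" "y \<noteq> -1"
  shows "squared_factor y = complex_of_real (y\<^sup>2 / (y\<^sup>2 - 1))"
proof -
  define s where "s = csqrt (complex_of_real (y\<^sup>2 - 1))"
  define z where "z = complex_of_real y + s"
  have s2: "s\<^sup>2 = (complex_of_real y)\<^sup>2 - 1"
    unfolding s_def by simp
  have "z * (complex_of_real y - s) = 1"
    using s2 unfolding z_def by (simp add: algebra_simps power2_eq_square)
  then have "z \<noteq> 0" by auto
  have "z\<^sup>2 + 1 = 2 * z * complex_of_real y" "1 - z\<^sup>2 = 2 * z * (- s)"
    using s2 unfolding z_def by (simp_all add: algebra_simps power2_eq_square)
  then have "(z\<^sup>2 + 1) / (1 - z\<^sup>2) = complex_of_real y / (- s)"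
    using \<open>z \<noteq> 0\<close> by (metis (no_types, lifting) mult_divide_mult_cancel_left mult_eq_0_iff zero_neq_numeral)
  then have "squared_factor y = (complex_of_real y)\<^sup>2 / s\<^sup>2"
    unfolding squared_factor_def Let_def s_def[symmetric] z_def[symmetric]
    by (simp add: power_divide)
  then show ?thesis
    by (simp add: s2)
qed

lemma deriv_log_potential:
  assumes U: "((\<lambda>t. V (phi_of t)) has_real_derivative U') (at x)" and nz: "V (phi_of x) \<noteq> 0"
  shows "deriv (log_potential V) x = U' / V (phi_of x)"
proof -
  define v where "v = (\<lambda>t. V (phi_of t))"
  \<comment> \<open>Writing the logarithm through the square of \<open>v\<close> lets one
    differentiation cover both signs of the potential.\<close>
  have eq: "log_potential V = (\<lambda>t. ln ((v t)\<^sup>2) / 2)"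
    by (auto simp: v_def log_potential_def ln_realpow abs_if ln_minus)
  have v: "v x \<noteq> 0" "(v has_real_derivative U') (at x)"
    using assms by (simp_all add: v_def)
  have "((\<lambda>t. (v t)\<^sup>2) has_real_derivative 2 * v x * U') (at x)"
    by (rule derivative_eq_intros v refl | simp)+
  moreover have "0 < (v x)\<^sup>2" using v(1) by simp
  ultimately have "((\<lambda>t. ln ((v t)\<^sup>2) / 2) has_real_derivative 1 / (v x)\<^sup>2 * (2 * v x * U') / 2) (at x)"
    by (intro DERIV_cdivide DERIV_chain2[OF DERIV_ln_divide])
  moreover have "1 / (v x)\<^sup>2 * (2 * v x * U') / 2 = U' / v x"
    using v(1) by (simp add: power2_eq_square)
  ultimately show ?thesis
    unfolding eq v_def by (simp add: DERIV_imp_deriv)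
qed

lemma potential_has_real_derivative:
  assumes "V differentiable (at (phi_of x))"
  obtains U' where "((\<lambda>t. V (phi_of t)) has_real_derivative U') (at x)"
proof -
  obtain D where "(V has_real_derivative D) (at (phi_of x))"
    using assms real_differentiable_def by blast
  from DERIV_chain2[OF this phi_of_has_real_derivative] that show ?thesis by blast
qed

text \<open>Bridge from the complex formula in the theorem to the real identity with which all later
  lemmas work.\<close>

lemma complex_hamiltonian_eq_iff:
  assumes "y \<noteq> 1" "y \<noteq> -1"
  shows "complex_of_real w = complex_of_real v * squared_factor y \<longleftrightarrow> w = v * (y\<^sup>2 / (y\<^sup>2 - 1))"
  unfolding squared_factor_eq[OF assms] of_real_mult[symmetric] of_real_eq_iff ..

section \<open>Correspondence between hamiltonians and solutions of the Abel equation\<close>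

text \<open>The hamiltonian equation reads \<open>p\<^sup>2 = W\<^sup>2 - V W\<close> for
  \<open>p = W'\<close>, whose right side is differentiable; as \<open>p\<close> does not vanish,
  \<open>p\<close> is differentiable too. Then \<open>y = \<kappa> W / p\<close> may be
  differentiated, and \<open>y\<^sup>2 - 1 = V W / p\<^sup>2\<close> is nonzero.\<close>

lemma regular_hamiltonian_imp_abel_solution:
  assumes \<kappa>: "\<kappa> \<in> {1, -1}" and S: "open S"
    and V: "\<And>x. x \<in> S \<Longrightarrow> V (phi_of x) \<noteq> 0 \<and> V differentiable (at (phi_of x))"
    and W: "regular_hamiltonian_x V S W"
  defines "y \<equiv> \<lambda>x. \<kappa> * W x / deriv W x"
  shows "abel_solution V \<kappa> S y"
    and "\<And>x. x \<in> S \<Longrightarrow> W x = V (phi_of x) * ((y x)\<^sup>2 / ((y x)\<^sup>2 - 1))"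
proof -
  define p where "p = deriv W"
  have \<kappa>2: "\<kappa>\<^sup>2 = 1" using \<kappa> by auto
  have W0: "W x \<noteq> 0" and p0: "p x \<noteq> 0" and W': "(W has_real_derivative p x) (at x)"
    and VW: "V (phi_of x) = W x - (p x)\<^sup>2 / W x" if "x \<in> S" for x
    using W that DERIV_deriv_iff_field_differentiable
    unfolding regular_hamiltonian_x_def hamiltonian_x_iff p_def by blast+
  have p2: "(p x)\<^sup>2 = (W x)\<^sup>2 - V (phi_of x) * W x" if "x \<in> S" for x
    using VW[OF that] W0[OF that] by (simp add: field_simps power2_eq_square)
  have y2: "(y x)\<^sup>2 = (W x)\<^sup>2 / (p x)\<^sup>2" for x
    by (simp add: power_divide power_mult_distrib \<kappa>2 y_def p_def)
  have y21: "(y x)\<^sup>2 - 1 = V (phi_of x) * W x / (p x)\<^sup>2" if "x \<in> S" for x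
    unfolding y2 using p0[OF that] p2[OF that] by (simp add: field_simps)
  show "W x = V (phi_of x) * ((y x)\<^sup>2 / ((y x)\<^sup>2 - 1))" if "x \<in> S" for x
    unfolding y21[OF that] unfolding y2 using p0[OF that] W0[OF that] V[OF that]
    by (simp add: field_simps power2_eq_square)
  show "abel_solution V \<kappa> S y"
    unfolding abel_solution_def
  proof (intro ballI conjI)
    fix x assume x: "x \<in> S"
    note nz = W0[OF x] p0[OF x] conjunct1[OF V[OF x]]
    have "(y x)\<^sup>2 \<noteq> 1"
      using y21[OF x] nz by auto
    then show "y x \<noteq> 1" "y x \<noteq> -1" by auto
    obtain U' where U': "((\<lambda>t. V (phi_of t)) has_real_derivative U') (at x)"
      using potential_has_real_derivative V[OF x] by blast
    \<comment> \<open>The derivative of \<open>W\<^sup>2 - V W\<close> divided by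
      \<open>2 * p\<close>, as the square root lemma predicts.\<close>
    define p' where "p' = (2 * W x * p x - (U' * W x + p x * V (phi_of x))) / (2 * p x)"
    have p': "(p has_real_derivative p') (at x)"
      unfolding p'_def
    proof (rule derivative_sqrt_has_real_derivative[OF S x W' p0 p2])
      show "((\<lambda>t. (W t)\<^sup>2 - V (phi_of t) * W t) has_real_derivative
          2 * W x * p x - (U' * W x + p x * V (phi_of x))) (at x)"
        by (rule derivative_eq_intros U' W'[OF x] refl | simp)+
    qed auto
    have "((\<lambda>t. \<kappa> * W t / p t) has_real_derivative (\<kappa> * p x * p x - \<kappa> * W x * p') / (p x * p x)) (at x)"
      by (rule derivative_eq_intros p' W'[OF x] refl nz | simp)+
    moreover have "(\<kappa> * p x * p x - \<kappa> * W x * p') / (p x * p x)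
        = - (1 / 2) * ((y x)\<^sup>2 - 1) * (\<kappa> - deriv (log_potential V) x * y x)"
    proof -
      \<comment> \<open>The quotient rule result is expanded by \<open>2 * q\<close> to clear the
        denominator of \<open>p'\<close>. Eliminating \<open>q\<^sup>2\<close> from the numerator by
        \<open>q2\<close> cancels the terms in \<open>w\<^sup>2 * q\<close>, and what remains
        factors as the right side of the Abel equation.\<close>
      define u w q where "u = V (phi_of x)" "w = W x" "q = p x"
      have q2: "q\<^sup>2 = w\<^sup>2 - u * w" and nz: "u \<noteq> 0" "w \<noteq> 0" "q \<noteq> 0"
        using p2[OF x] nz by (simp_all add: u_w_q_def)
      have "(\<kappa> * q * q - \<kappa> * w * p') / (q * q) = \<kappa> * (2 * q * q\<^sup>2 - 2 * w\<^sup>2 * q + U' * w\<^sup>2 + w * q * u) / (2 * q * q\<^sup>2)"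
        unfolding p'_def u_w_q_def[symmetric] using nz by (simp add: field_simps power2_eq_square)
      also have "2 * q * q\<^sup>2 - 2 * w\<^sup>2 * q + U' * w\<^sup>2 + w * q * u = U' * w\<^sup>2 - w * q * u"
        unfolding q2 by (simp add: algebra_simps power2_eq_square)
      also have "\<kappa> * (U' * w\<^sup>2 - w * q * u) / (2 * q * q\<^sup>2)
          = - (1 / 2) * (u * w / q\<^sup>2) * (\<kappa> - U' / u * (\<kappa> * w / q))"
        using nz by (simp add: field_simps power2_eq_square)
      finally show ?thesis
        unfolding y21[OF x] deriv_log_potential[OF U' conjunct1[OF V[OF x]]]
        by (simp add: u_w_q_def y_def p_def)
    qed
    ultimately show "(y has_real_derivative
        - (1 / 2) * ((y x)\<^sup>2 - 1) * (\<kappa> - deriv (log_potential V) x * y x)) (at x)"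
      by (simp add: y_def p_def)
  qed
qed

text \<open>Differentiating \<open>V y\<^sup>2 / (y\<^sup>2 - 1)\<close> and inserting the Abel
  equation cancels the terms with \<open>V'\<close> and leaves \<open>W' = \<kappa> W / y\<close>.
  So \<open>W - W'\<^sup>2 / W\<close> is \<open>W (y\<^sup>2 - 1) / y\<^sup>2\<close>, which is
  \<open>V\<close>. The second claim is the inverse formula that makes the correspondence
  injective.\<close>

lemma abel_solution_imp_regular_hamiltonian:
  assumes \<kappa>: "\<kappa> \<in> {1, -1}" and S: "open S"
    and V: "\<And>x. x \<in> S \<Longrightarrow> V (phi_of x) \<noteq> 0 \<and> V differentiable (at (phi_of x))"
    and y: "abel_solution V \<kappa> S y"
    and W: "\<And>x. x \<in> S \<Longrightarrow> W x = V (phi_of x) * ((y x)\<^sup>2 / ((y x)\<^sup>2 - 1))"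
    and W0: "\<And>x. x \<in> S \<Longrightarrow> W x \<noteq> 0"
  shows "regular_hamiltonian_x V S W"
    and "\<And>x. x \<in> S \<Longrightarrow> y x = \<kappa> * W x / deriv W x"
proof -
  have \<kappa>2: "\<kappa>\<^sup>2 = 1" using \<kappa> by auto
  have key: "(W has_real_derivative \<kappa> * W x / y x) (at x)" "y x \<noteq> 0" "(y x)\<^sup>2 - 1 \<noteq> 0" if x: "x \<in> S" for x
  proof -
    show y0: "y x \<noteq> 0" using W[OF x] W0[OF x] by auto
    \<comment> \<open>Division by zero has the value 0, so \<open>y\<^sup>2 = 1\<close> would make
      the given formula yield \<open>W x = 0\<close>.\<close>
    show y1: "(y x)\<^sup>2 - 1 \<noteq> 0" using W[OF x] W0[OF x] by auto
    obtain U' where U': "((\<lambda>t. V (phi_of t)) has_real_derivative U') (at x)"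
      using potential_has_real_derivative V[OF x] by blast
    define u b where "u = V (phi_of x)" "b = (y x)\<^sup>2 - 1"
    define y' where "y' = - (1 / 2) * b * (\<kappa> - U' / u * y x)"
    have u0: "u \<noteq> 0" and b0: "b \<noteq> 0" using V[OF x] y1 by (auto simp: u_b_def)
    have y': "(y has_real_derivative y') (at x)"
      using y x deriv_log_potential[OF U'] V[OF x] unfolding abel_solution_def y'_def u_b_def by auto
    have "((\<lambda>t. V (phi_of t) * ((y t)\<^sup>2 / ((y t)\<^sup>2 - 1))) has_real_derivative
        U' * ((y x)\<^sup>2 / b) + (2 * y x * y' * b - (y x)\<^sup>2 * (2 * y x * y')) / (b * b) * u) (at x)"
      unfolding u_b_def by (rule derivative_eq_intros U' y' refl y1 | simp)+
    \<comment> \<open>The numerator is \<open>2 * y * y'\<close> times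
      \<open>b - y\<^sup>2 = -1\<close>.\<close>
    also have "2 * y x * y' * b - (y x)\<^sup>2 * (2 * y x * y') = - 2 * y x * y'"
      by (simp add: u_b_def algebra_simps)
    also have "U' * ((y x)\<^sup>2 / b) + (- 2 * y x * y') / (b * b) * u = \<kappa> * (u * y x / b)"
      unfolding y'_def using u0 b0 by (simp add: field_simps power2_eq_square)
    also have "u * y x / b = W x / y x"
      unfolding W[OF x] u_b_def using y0 by (simp add: power2_eq_square)
    finally have "((\<lambda>t. V (phi_of t) * ((y t)\<^sup>2 / ((y t)\<^sup>2 - 1))) has_real_derivative \<kappa> * W x / y x) (at x)"
      by simp
    then show "(W has_real_derivative \<kappa> * W x / y x) (at x)"
      by (rule has_field_derivative_transform_within_open[OF _ S x]) (simp add: W)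
  qed
  have der: "deriv W x = \<kappa> * W x / y x" if "x \<in> S" for x
    using key(1)[OF that] by (rule DERIV_imp_deriv)
  show "y x = \<kappa> * W x / deriv W x" if "x \<in> S" for x
    unfolding der[OF that] using \<kappa> key(2)[OF that] W0[OF that] by auto
  show "regular_hamiltonian_x V S W"
    unfolding regular_hamiltonian_x_def hamiltonian_x_iff
  proof (intro conjI ballI)
    fix x assume x: "x \<in> S"
    show "W x \<noteq> 0" using W0[OF x] .
    show "W field_differentiable (at x)" using key(1)[OF x] field_differentiable_def by blast
    show "deriv W x \<noteq> 0" unfolding der[OF x] using \<kappa> key(2)[OF x] W0[OF x] by auto
    have "W x - (deriv W x)\<^sup>2 / W x = W x * (((y x)\<^sup>2 - 1) / (y x)\<^sup>2)"
      unfolding der[OF x] power_divide power_mult_distrib \<kappa>2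
      using key(2)[OF x] W0[OF x] by (simp add: field_simps power2_eq_square)
    also have "\<dots> = V (phi_of x)"
      unfolding W[OF x] using key(2,3)[OF x] by simp
    finally show "V (phi_of x) = W x - (deriv W x)\<^sup>2 / W x" ..
  qed
qed

section \<open>Transfer of the general solution\<close>

text \<open>The maps from \<open>y\<close> to \<open>W\<close> and from \<open>W\<close> to
  \<open>\<kappa> W / W'\<close> are mutually inverse on solutions, so the same constants
  parametrize both families. Zeros of \<open>y(., C)\<close> are zeros of \<open>W(., C)\<close>,
  where the hamiltonian equation is excluded; this is why each domain shrinks to the points with
  \<open>W x C \<noteq> 0\<close>.\<close>

lemma general_solution_hamiltonian:
  assumes \<kappa>: "\<kappa> \<in> {1, -1}"
    and V: "\<And>x. x \<in> I \<Longrightarrow> V (phi_of x) \<noteq> 0 \<and> V differentiable (at (phi_of x))"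
    and gen: "general_solution (abel_solution V \<kappa>) I P D y"
    and W: "\<And>C x. C \<in> P \<Longrightarrow> x \<in> D C \<Longrightarrow> W x C = V (phi_of x) * ((y x C)\<^sup>2 / ((y x C)\<^sup>2 - 1))"
  shows "general_solution (regular_hamiltonian_x V) I P (\<lambda>C. {x \<in> D C. W x C \<noteq> 0}) W"
proof -
  have D: "open (D C)" "D C \<noteq> {}" "D C \<subseteq> I" and abel: "abel_solution V \<kappa> (D C) (\<lambda>x. y x C)" if "C \<in> P" for C
    using gen that unfolding general_solution_def by blast+
  have y_der: "((\<lambda>x. y x C) has_real_derivative
      - (1 / 2) * ((y x C)\<^sup>2 - 1) * (\<kappa> - deriv (log_potential V) x * y x C)) (at x)"
    and y1: "(y x C)\<^sup>2 - 1 \<noteq> 0" if "C \<in> P" "x \<in> D C" for C x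
    using abel[OF that(1)] that(2) unfolding abel_solution_def by (auto simp: power2_eq_1_iff)
  have W_iff: "W x C \<noteq> 0 \<longleftrightarrow> y x C \<noteq> 0" if "C \<in> P" "x \<in> D C" for C x
    using W[OF that] y1[OF that] V[of x] D(3)[OF that(1)] that(2) by auto
  have abel_sub: "abel_solution V \<kappa> T (\<lambda>x. y x C)" if "C \<in> P" "T \<subseteq> D C" for T C
    using abel[OF that(1)] that(2) unfolding abel_solution_def by blast
  show ?thesis
    unfolding general_solution_def
  proof (intro conjI ballI allI impI)
    fix C assume C: "C \<in> P"
    have eq: "{x \<in> D C. W x C \<noteq> 0} = D C \<inter> (\<lambda>x. y x C) -` (- {0})"
      using W_iff[OF C] by auto
    have "continuous_on (D C) (\<lambda>x. y x C)"
      using y_der[OF C] by (meson DERIV_isCont continuous_at_imp_continuous_on)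
    then show op: "open {x \<in> D C. W x C \<noteq> 0}"
      unfolding eq by (intro continuous_open_preimage D C) auto
    show sub: "{x \<in> D C. W x C \<noteq> 0} \<subseteq> I" using D(3)[OF C] by auto
    \<comment> \<open>The shrunken domain could be empty only if \<open>y\<close> vanished on the
      whole open set \<open>D C\<close>, but at a zero of \<open>y\<close> the Abel equation forces
      the slope \<open>\<kappa> / 2\<close>.\<close>
    show "{x \<in> D C. W x C \<noteq> 0} \<noteq> {}"
    proof
      assume "{x \<in> D C. W x C \<noteq> 0} = {}"
      then have zero: "y x C = 0" if "x \<in> D C" for x using W_iff[OF C that] that by blast
      obtain x where x: "x \<in> D C" using D(2)[OF C] by blast
      have "((\<lambda>x. y x C) has_real_derivative 0) (at x)"
        by (rule has_field_derivative_transform_within_open[OF DERIV_const D(1)[OF C] x]) (simp add: zero)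
      moreover have "((\<lambda>x. y x C) has_real_derivative \<kappa> / 2) (at x)"
        using y_der[OF C x] zero[OF x] by simp
      ultimately show False using \<kappa> DERIV_unique by fastforce
    qed
    show "regular_hamiltonian_x V {x \<in> D C. W x C \<noteq> 0} (\<lambda>x. W x C)"
      by (rule abel_solution_imp_regular_hamiltonian(1)[OF \<kappa> op, where y = "\<lambda>x. y x C"])
        (use V sub W[OF C] abel_sub[OF C] in auto)
  next
    fix J v
    assume A: "open J \<and> is_interval J \<and> J \<noteq> {} \<and> J \<subseteq> I \<and> regular_hamiltonian_x V J v"
    then have VJ: "V (phi_of x) \<noteq> 0 \<and> V differentiable (at (phi_of x))" if "x \<in> J" for x
      using V that by blast
    have oJ: "open J" and vJ: "regular_hamiltonian_x V J v" using A by auto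
    \<comment> \<open>The Abel solution belonging to \<open>v\<close>. It has exactly one constant
      \<open>C\<close>, and the equivalence proved below for every \<open>C\<close> hands this
      unique constant over to \<open>v\<close>.\<close>
    define z where "z = (\<lambda>x. \<kappa> * v x / deriv v x)"
    have z: "abel_solution V \<kappa> J z"
      and vz: "v x = V (phi_of x) * ((z x)\<^sup>2 / ((z x)\<^sup>2 - 1))" if "x \<in> J" for x
      using regular_hamiltonian_imp_abel_solution[OF \<kappa> oJ VJ vJ] that unfolding z_def by blast+
    have v0: "v x \<noteq> 0" if "x \<in> J" for x
      using vJ that unfolding regular_hamiltonian_x_def hamiltonian_x_iff by blast
    have ex1: "\<exists>!C. C \<in> P \<and> J \<subseteq> D C \<and> (\<forall>x\<in>J. z x = y x C)"
      using gen A z unfolding general_solution_def by blast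
    have "(C \<in> P \<and> J \<subseteq> {x \<in> D C. W x C \<noteq> 0} \<and> (\<forall>x\<in>J. v x = W x C)) \<longleftrightarrow>
        (C \<in> P \<and> J \<subseteq> D C \<and> (\<forall>x\<in>J. z x = y x C))" for C
    proof (cases "C \<in> P \<and> J \<subseteq> D C")
      case True
      then have C: "C \<in> P" and sub: "J \<subseteq> D C" by auto
      \<comment> \<open>If \<open>v\<close> agrees with \<open>W(., C)\<close> on \<open>J\<close>,
        the inverse formula recovers \<open>y(., C)\<close> from \<open>v\<close>, and that value is
        \<open>z\<close> by definition.\<close>
      have "z x = y x C" if "\<forall>x\<in>J. v x = W x C" "x \<in> J" for x
        unfolding z_def
        by (rule abel_solution_imp_regular_hamiltonian(2)[OF \<kappa> oJ VJ abel_sub[OF C sub], symmetric])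
          (use that v0 W[OF C] sub in \<open>auto simp: subset_eq\<close>)
      moreover have "v x = W x C" if "\<forall>x\<in>J. z x = y x C" "x \<in> J" for x
        using vz[OF that(2)] W[OF C] sub that by auto
      ultimately show ?thesis using True v0 by (auto simp: subset_eq)
    qed auto
    with ex1 show "\<exists>!C. C \<in> P \<and> J \<subseteq> {x \<in> D C. W x C \<noteq> 0} \<and> (\<forall>x\<in>J. v x = W x C)"
      by simp
  qed
qed

section \<open>The case of zero potential\<close>

lemma continuous_on_nonzero_imp_constant_sign:
  fixes f :: "'a::topological_space \<Rightarrow> real"
  assumes "connected S" "continuous_on S f" and nz: "\<And>x. x \<in> S \<Longrightarrow> f x \<noteq> 0"
  shows "(\<forall>x\<in>S. f x > 0) \<or> (\<forall>x\<in>S. f x < 0)"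
proof (rule ccontr)
  assume "\<not> ?thesis"
  then obtain a b where ab: "a \<in> S" "b \<in> S" "f a \<le> 0" "0 \<le> f b"
    by (meson not_less)
  have "connected (f ` S)"
    using assms by (simp add: connected_continuous_image)
  then have "0 \<in> f ` S"
    using ab connectedD_interval[of "f ` S" "f a" "f b" 0] by blast
  then show False using nz by force
qed

text \<open>With zero potential the equation is \<open>W'\<^sup>2 = W\<^sup>2\<close>, which allows
  a different sign at each point. \<open>W\<close> keeps its sign by continuity and
  \<open>W'\<close> by Darboux, so a single \<open>\<kappa>\<close> serves all of \<open>I\<close>,
  and then \<open>W * exp (- \<kappa> * x)\<close> has derivative 0.\<close>

lemma hamiltonian_of_zero_potential_iff:
  assumes I: "open I" "is_interval I" "I \<noteq> {}"
    and V: "\<And>x. x \<in> I \<Longrightarrow> V (phi_of x) = 0"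
  shows "hamiltonian_x V I W \<longleftrightarrow>
    (\<exists>C \<kappa>. C \<noteq> 0 \<and> \<kappa> \<in> {1, -1} \<and> (\<forall>x\<in>I. W x = C * exp (\<kappa> * x)))"
proof
  assume H: "hamiltonian_x V I W"
  define p where "p = deriv W"
  have W0: "W x \<noteq> 0" and W': "(W has_real_derivative p x) (at x)"
    and VW: "V (phi_of x) = W x - (p x)\<^sup>2 / W x" if "x \<in> I" for x
    using H that DERIV_deriv_iff_field_differentiable unfolding hamiltonian_x_iff p_def by blast+
  have p2: "(p x)\<^sup>2 = (W x)\<^sup>2" if "x \<in> I" for x
    using VW[OF that] V[OF that] W0[OF that] by (simp add: field_simps power2_eq_square)
  then have p0: "p x \<noteq> 0" if "x \<in> I" for x
    using W0 that by fastforce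
  have p_sign: "(\<forall>x\<in>I. p x > 0) \<or> (\<forall>x\<in>I. p x < 0)"
    using I(1,2) W' p0 by (rule derivative_nonzero_imp_constant_sign)
  have "continuous_on I W"
    using W' by (meson DERIV_isCont continuous_at_imp_continuous_on)
  with W0 I(2) have W_sign: "(\<forall>x\<in>I. W x > 0) \<or> (\<forall>x\<in>I. W x < 0)"
    by (intro continuous_on_nonzero_imp_constant_sign is_interval_connected)
  obtain \<kappa> :: real where \<kappa>: "\<kappa> \<in> {1, -1}" and pW: "\<And>x. x \<in> I \<Longrightarrow> p x = \<kappa> * W x"
  proof -
    have "(\<forall>x\<in>I. p x = 1 * W x) \<or> (\<forall>x\<in>I. p x = -1 * W x)"
    \<comment> \<open>Each function has one sign on \<open>I\<close>: \<open>\<kappa>\<close> is 1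
      if the two signs agree and -1 otherwise.\<close>
    proof (cases "(\<forall>x\<in>I. p x > 0) \<longleftrightarrow> (\<forall>x\<in>I. W x > 0)")
      case True
      then have "p x = W x" if "x \<in> I" for x
        using p_sign W_sign p2[OF that] that unfolding power2_eq_iff by fastforce
      then show ?thesis by simp
    next
      case False
      then have "p x = - W x" if "x \<in> I" for x
        using p_sign W_sign p2[OF that] that unfolding power2_eq_iff by fastforce
      then show ?thesis by simp
    qed
    then show ?thesis using that by blast
  qed
  have "\<exists>C. \<forall>x\<in>I. W x * exp (- \<kappa> * x) = C"
  proof (rule has_field_derivative_zero_constant)
    show "convex I" using I(2) by (simp add: is_interval_convex)
    fix x assume x: "x \<in> I"
    show "((\<lambda>x. W x * exp (- \<kappa> * x)) has_real_derivative 0) (at x within I)"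
      by (rule has_field_derivative_at_within)
        (rule derivative_eq_intros W'[OF x] refl | simp add: pW[OF x])+
  qed
  then obtain C where C: "\<And>x. x \<in> I \<Longrightarrow> W x * exp (- \<kappa> * x) = C" by blast
  then have "W x = C * exp (\<kappa> * x)" if "x \<in> I" for x
    using C[OF that, symmetric] by (simp add: mult.assoc flip: exp_add)
  moreover have "C \<noteq> 0" using C W0 I(3) by fastforce
  ultimately show "\<exists>C \<kappa>. C \<noteq> 0 \<and> \<kappa> \<in> {1, -1} \<and> (\<forall>x\<in>I. W x = C * exp (\<kappa> * x))"
    using \<kappa> by blast
next
  assume "\<exists>C \<kappa>. C \<noteq> 0 \<and> \<kappa> \<in> {1, -1} \<and> (\<forall>x\<in>I. W x = C * exp (\<kappa> * x))"
  then obtain C \<kappa> where C: "C \<noteq> 0" and \<kappa>: "\<kappa> \<in> {1, -1::real}"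
    and W: "\<And>x. x \<in> I \<Longrightarrow> W x = C * exp (\<kappa> * x)" by blast
  have der: "(W has_real_derivative \<kappa> * W x) (at x)" if x: "x \<in> I" for x
  proof -
    have "((\<lambda>x. C * exp (\<kappa> * x)) has_real_derivative \<kappa> * W x) (at x)"
      unfolding W[OF x] by (rule derivative_eq_intros refl | simp)+
    then show ?thesis
      by (rule has_field_derivative_transform_within_open[OF _ I(1) x]) (simp add: W)
  qed
  show "hamiltonian_x V I W"
    unfolding hamiltonian_x_iff
  proof (intro ballI conjI)
    fix x assume x: "x \<in> I"
    show "W x \<noteq> 0" using W[OF x] C by simp
    show "W field_differentiable (at x)" using der[OF x] field_differentiable_def by blast
    show "V (phi_of x) = W x - (deriv W x)\<^sup>2 / W x"
      unfolding DERIV_imp_deriv[OF der[OF x]] V[OF x] using \<kappa> by (auto simp: power2_eq_square)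
  qed
qed

text \<open>The relation is taken without a denominator so that it makes sense at
  \<open>y = 1\<close> and \<open>y = -1\<close>; since \<open>W x\<close> is nonzero, either side
  vanishes exactly in the stated case.\<close>

lemma zero_potential_iff:
  assumes "hamiltonian_x V I W" "x \<in> I" "W x * (y\<^sup>2 - 1) = V (phi_of x) * y\<^sup>2"
  shows "V (phi_of x) = 0 \<longleftrightarrow> y = 1 \<or> y = -1"
proof -
  have "W x \<noteq> 0"
    using assms unfolding hamiltonian_x_iff by blast
  with assms(3) show ?thesis
    by (auto simp: power2_eq_1_iff)
qed

section \<open>Assembly of the claims\<close>

theorem theorem1:
  fixes V :: "real \<Rightarrow> real" and I :: "real set"
  assumes "open I" and "is_interval I" and "I \<noteq> {}"
  shows
    "(\<forall>\<kappa>\<in>{1, -1}.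
        (\<forall>x\<in>I. V (phi_of x) \<noteq> 0 \<and> V differentiable (at (phi_of x))) \<longrightarrow>
        (\<forall>P D y W.
           general_solution (abel_solution V \<kappa>) I P D y \<and>
           (\<forall>C\<in>P. \<forall>x\<in>D C. complex_of_real (W x C)
                = complex_of_real (V (phi_of x)) * squared_factor (y x C)) \<longrightarrow>
           general_solution (regular_hamiltonian_x V) I P (\<lambda>C. {x \<in> D C. W x C \<noteq> 0}) W) \<and>
        (\<forall>S W. open S \<and> S \<subseteq> I \<longrightarrow>
           (regular_hamiltonian_x V S W \<longleftrightarrow>
             (\<exists>y. abel_solution V \<kappa> S y \<and>
                (\<forall>x\<in>S. W x \<noteq> 0 \<and> complex_of_real (W x)
                   = complex_of_real (V (phi_of x)) * squared_factor (y x)))))) \<and>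
     (\<forall>W y. hamiltonian_x V I W \<and>
        (\<forall>x\<in>I. W x * ((y x)\<^sup>2 - 1) = V (phi_of x) * (y x)\<^sup>2) \<longrightarrow>
        (\<forall>x\<in>I. V (phi_of x) = 0 \<longleftrightarrow> y x = 1 \<or> y x = -1) \<and>
        (continuous_on I y \<longrightarrow>
           ((\<forall>x\<in>I. V (phi_of x) = 0) \<longleftrightarrow> (\<forall>x\<in>I. y x = 1) \<or> (\<forall>x\<in>I. y x = -1)))) \<and>
     ((\<forall>x\<in>I. V (phi_of x) = 0) \<longrightarrow>
        (\<forall>W. hamiltonian_x V I W \<longleftrightarrow>
           (\<exists>C \<kappa>. C \<noteq> 0 \<and> \<kappa> \<in> {1, -1} \<and> (\<forall>x\<in>I. W x = C * exp (\<kappa> * x)))))"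
proof (intro conjI ballI allI impI)
  fix \<kappa> :: real and P D and y W :: "real \<Rightarrow> real \<Rightarrow> real"
  assume \<kappa>: "\<kappa> \<in> {1, -1}" and V: "\<forall>x\<in>I. V (phi_of x) \<noteq> 0 \<and> V differentiable (at (phi_of x))"
    and A: "general_solution (abel_solution V \<kappa>) I P D y \<and>
           (\<forall>C\<in>P. \<forall>x\<in>D C. complex_of_real (W x C)
                = complex_of_real (V (phi_of x)) * squared_factor (y x C))"
  have "W x C = V (phi_of x) * ((y x C)\<^sup>2 / ((y x C)\<^sup>2 - 1))" if "C \<in> P" "x \<in> D C" for C x
  proof -
    \<comment> \<open>Abel solutions avoid 1 and -1 by definition, which is what the real form of
      the squared factor requires.\<close>
    have "y x C \<noteq> 1" "y x C \<noteq> -1"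
      using A that unfolding general_solution_def abel_solution_def by blast+
    with A that show ?thesis by (metis complex_hamiltonian_eq_iff)
  qed
  with A V \<kappa> show "general_solution (regular_hamiltonian_x V) I P (\<lambda>C. {x \<in> D C. W x C \<noteq> 0}) W"
    by (intro general_solution_hamiltonian) auto
next
  fix \<kappa> :: real and S W
  assume \<kappa>: "\<kappa> \<in> {1, -1}" and V: "\<forall>x\<in>I. V (phi_of x) \<noteq> 0 \<and> V differentiable (at (phi_of x))"
    and S: "open S \<and> S \<subseteq> I"
  have VS: "V (phi_of x) \<noteq> 0 \<and> V differentiable (at (phi_of x))" if "x \<in> S" for x
    using V S that by blast
  \<comment> \<open>For a fixed Abel solution the complex condition becomes the real one, so both
    directions reduce to the two correspondence lemmas.\<close>
  have real_form: "(\<forall>x\<in>S. W x \<noteq> 0 \<and> complex_of_real (W x)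
          = complex_of_real (V (phi_of x)) * squared_factor (y x)) \<longleftrightarrow>
        (\<forall>x\<in>S. W x \<noteq> 0 \<and> W x = V (phi_of x) * ((y x)\<^sup>2 / ((y x)\<^sup>2 - 1)))"
    if "abel_solution V \<kappa> S y" for y
    using that unfolding abel_solution_def by (metis complex_hamiltonian_eq_iff)
  show "regular_hamiltonian_x V S W \<longleftrightarrow>
      (\<exists>y. abel_solution V \<kappa> S y \<and> (\<forall>x\<in>S. W x \<noteq> 0 \<and> complex_of_real (W x)
                   = complex_of_real (V (phi_of x)) * squared_factor (y x)))"
  proof
    assume W: "regular_hamiltonian_x V S W"
    then have "\<forall>x\<in>S. W x \<noteq> 0"
      unfolding regular_hamiltonian_x_def hamiltonian_x_iff by blast
    then show "\<exists>y. abel_solution V \<kappa> S y \<and> (\<forall>x\<in>S. W x \<noteq> 0 \<and> complex_of_real (W x)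
                   = complex_of_real (V (phi_of x)) * squared_factor (y x))"
      using regular_hamiltonian_imp_abel_solution[OF \<kappa> conjunct1[OF S] VS W] real_form by blast
  next
    assume "\<exists>y. abel_solution V \<kappa> S y \<and> (\<forall>x\<in>S. W x \<noteq> 0 \<and> complex_of_real (W x)
                   = complex_of_real (V (phi_of x)) * squared_factor (y x))"
    then obtain y where y: "abel_solution V \<kappa> S y"
      and W: "\<And>x. x \<in> S \<Longrightarrow> W x = V (phi_of x) * ((y x)\<^sup>2 / ((y x)\<^sup>2 - 1))" "\<And>x. x \<in> S \<Longrightarrow> W x \<noteq> 0"
      using real_form by blast
    from abel_solution_imp_regular_hamiltonian(1)[OF \<kappa> conjunct1[OF S] VS y W]
    show "regular_hamiltonian_x V S W" .
  qed
next
  fix W y x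
  assume "hamiltonian_x V I W \<and> (\<forall>x\<in>I. W x * ((y x)\<^sup>2 - 1) = V (phi_of x) * (y x)\<^sup>2)" "x \<in> I"
  then show "V (phi_of x) = 0 \<longleftrightarrow> y x = 1 \<or> y x = -1"
    using zero_potential_iff by blast
next
  fix W y
  assume H: "hamiltonian_x V I W \<and> (\<forall>x\<in>I. W x * ((y x)\<^sup>2 - 1) = V (phi_of x) * (y x)\<^sup>2)"
    and cont: "continuous_on I y"
  have iff: "V (phi_of x) = 0 \<longleftrightarrow> y x = 1 \<or> y x = -1" if "x \<in> I" for x
    using H that zero_potential_iff by blast
  \<comment> \<open>The relation determines only \<open>y\<^sup>2\<close>, so \<open>y\<close> could
    switch between 1 and -1 from point to point; continuity on the connected set \<open>I\<close>
    rules this out.\<close>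
  have "(\<forall>x\<in>I. y x = 1) \<or> (\<forall>x\<in>I. y x = -1)" if y: "\<And>x. x \<in> I \<Longrightarrow> y x = 1 \<or> y x = -1"
  proof -
    have "(\<forall>x\<in>I. y x > 0) \<or> (\<forall>x\<in>I. y x < 0)"
      using is_interval_connected[OF assms(2)] cont
      by (rule continuous_on_nonzero_imp_constant_sign) (use y in force)
    with y show ?thesis by fastforce
  qed
  with iff show "(\<forall>x\<in>I. V (phi_of x) = 0) \<longleftrightarrow> (\<forall>x\<in>I. y x = 1) \<or> (\<forall>x\<in>I. y x = -1)"
    by blast
next
  fix W
  assume "\<forall>x\<in>I. V (phi_of x) = 0"
  with assms show "hamiltonian_x V I W \<longleftrightarrow>
      (\<exists>C \<kappa>. C \<noteq> 0 \<and> \<kappa> \<in> {1, -1} \<and> (\<forall>x\<in>I. W x = C * exp (\<kappa> * x)))"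
    by (intro hamiltonian_of_zero_potential_iff) auto
qed

end
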